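(* Let $n$ be a positive integer and let $X_1,\dots,X_n$ be coarse spaces with $\operatorname{asdim}(X_i)\ge 1$ for every $i\in\{1,\dots,n\}$. Then the product coarse space $X=X_1\times\dots\times X_n$ has $\operatorname{asdim}(X)\ge n$.
   Context: An entourage on a set $X$ is a subset $E\subseteq X\times X$ such that $\Delta_X\subseteq E=E^{-1}$, where $\Delta_X=\{(x,x):x\in X\}$ and $E^{-1}=\{(y,x):(x,y)\in E\}$. For entourages $E,F$ on $X$, $E\circ F=\{(x,z):\exists y\ (x,y)\in E,\ (y,z)\in F\}$. For $x\in X$, the $E$-ball around $x$ is $E[x]=\{y\in X:(x,y)\in E\}$. A coarse structure on $X$ is a family $\mathcal E$ of entourages on $X$ such that (i) $E\circ F\in\mathcal E$ for all $E,F\in\mathcal E$; (ii) an entourage $F$ on $X$ belongs to $\mathcal E$ whenever $F\subseteq E$ for some $E\in\mathcal E$. A coarse space is a pair $(X,\mathcal E)$ of a set and a coarse structure on it. A base of $\mathcal E$ is a subfamily $\mathcal B\subseteq\mathcal E$ such that each $E\in\mathcal E$ is contained in some $B\in\mathcal B$; the coarse structure generated by a base $\mathcal B$ consists of all entourages contained in some $B\in\mathcal B$. The product of coarse spaces $(X_1,\mathcal E_1),\dots,(X_n,\mathcal E_n)$ is $X=X_1\times\dots\times X_n$ with the coarse structure generated by the base consisting of the entourages $\{((x_i)_{i=1}^n,(y_i)_{i=1}^n)\in X\times X:(x_i,y_i)\in E_i\text{ for all }i\}$, where $E_i\in\mathcal E_i$ for all $i\in\{1,\dots,n\}$. A cover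 $\mathcal U$ of a coarse space $(X,\mathcal E)$ is uniformly bounded if there is $E\in\mathcal E$ with $U\times U\subseteq E$ for every $U\in\mathcal U$. The asymptotic dimension $\operatorname{asdim}(X)$ is the smallest non-negative integer $n$ such that for any $E\in\mathcal E$ there is a uniformly bounded cover $\mathcal U$ of $X$ such that for every $x\in X$ the family $\{U\in\mathcal U:E[x]\cap U\ne\emptyset\}$ has cardinality $\le n+1$; if no such $n$ exists, then $\operatorname{asdim}(X)=\infty$, with $\infty\ge n$ for every non-negative integer $n$. *)

theory Defs
  imports "HOL-Library.FuncSet" "HOL-Library.Extended_Nat"
begin

definition entourage :: "'a set \<Rightarrow> 'a rel \<Rightarrow> bool" where
  "entourage X E \<longleftrightarrow> E \<subseteq> X \<times> X \<and> Id_on X \<subseteq> E \<and> E = E\<inverse>"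

text \<open>
  Entourages are symmetric, but \<open>E O F\<close> need not be, since its converse is \<open>F O E\<close>. Demanding
  \<open>E O F \<in> \<E>\<close> literally would rule out every space in which some member of \<open>\<E>\<close> relates a point
  to two other points, leaving only spaces of asymptotic dimension 0. The axiom is therefore stated
  as: \<open>E O F\<close> is contained in a member of \<open>\<E>\<close>. A family satisfying the literal axiom satisfies
  this one. The empty family is allowed; its asymptotic dimension is 0.
\<close>

definition coarse_structure :: "'a set \<Rightarrow> 'a rel set \<Rightarrow> bool" where
  "coarse_structure X \<E> \<longleftrightarrow>
     (\<forall>E\<in>\<E>. entourage X E) \<and>
     (\<forall>E\<in>\<E>. \<forall>F\<in>\<E>. \<exists>G\<in>\<E>. E O F \<subseteq> G) \<and>
     (\<forall>E\<in>\<E>. \<forall>F. entourage X F \<and> F \<subseteq> E \<longrightarrow> F \<in> \<E>)"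

definition coarse_generated :: "'a set \<Rightarrow> 'a rel set \<Rightarrow> 'a rel set" where
  "coarse_generated X \<B> = {E. entourage X E \<and> (\<exists>B\<in>\<B>. E \<subseteq> B)}"

definition product_entourage :: "'i set \<Rightarrow> ('i \<Rightarrow> 'a set) \<Rightarrow> ('i \<Rightarrow> 'a rel) \<Rightarrow> ('i \<Rightarrow> 'a) rel" where
  "product_entourage I X E =
     {(x, y). x \<in> Pi\<^sub>E I X \<and> y \<in> Pi\<^sub>E I X \<and> (\<forall>i\<in>I. (x i, y i) \<in> E i)}"

definition product_coarse :: "'i set \<Rightarrow> ('i \<Rightarrow> 'a set) \<Rightarrow> ('i \<Rightarrow> 'a rel set) \<Rightarrow> ('i \<Rightarrow> 'a) rel set" where
  "product_coarse I X \<E> =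
     coarse_generated (Pi\<^sub>E I X) {product_entourage I X E |E. \<forall>i\<in>I. E i \<in> \<E> i}"

definition uniformly_bounded_cover :: "'a set \<Rightarrow> 'a rel set \<Rightarrow> 'a set set \<Rightarrow> bool" where
  "uniformly_bounded_cover X \<E> \<U> \<longleftrightarrow>
     (\<forall>U\<in>\<U>. U \<subseteq> X) \<and> \<Union>\<U> = X \<and> (\<exists>E\<in>\<E>. \<forall>U\<in>\<U>. U \<times> U \<subseteq> E)"

definition asdim_le :: "'a set \<Rightarrow> 'a rel set \<Rightarrow> nat \<Rightarrow> bool" where
  "asdim_le X \<E> n \<longleftrightarrow>
     (\<forall>E\<in>\<E>. \<exists>\<U>. uniformly_bounded_cover X \<E> \<U> \<and>
        (\<forall>x\<in>X. finite {U\<in>\<U>. E `` {x} \<inter> U \<noteq> {}} \<and> card {U\<in>\<U>. E `` {x} \<inter> U \<noteq> {}} \<le> n + 1))"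

definition asdim :: "'a set \<Rightarrow> 'a rel set \<Rightarrow> enat" where
  "asdim X \<E> = (if \<exists>n. asdim_le X \<E> n then enat (LEAST n. asdim_le X \<E> n) else \<infinity>)"

lemma entourage_product_entourage:
  assumes "\<And>i. i \<in> I \<Longrightarrow> entourage (X i) (E i)"
  shows "entourage (Pi\<^sub>E I X) (product_entourage I X E)"
proof -
  have refl: "(x i, x i) \<in> E i" if "x \<in> Pi\<^sub>E I X" "i \<in> I" for x i
    using assms[OF that(2)] PiE_mem[OF that] by (auto simp: entourage_def)
  have sym: "(y, x) \<in> E i" if "(x, y) \<in> E i" "i \<in> I" for x y i
    using assms[OF that(2)] that(1) unfolding entourage_def by blast
  show ?thesis
    unfolding entourage_def product_entourage_def
    using refl sym by (auto simp: Id_on_def)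
qed

lemma coarse_structure_product_coarse:
  assumes "\<And>i. i \<in> I \<Longrightarrow> coarse_structure (X i) (\<E> i)"
  shows "coarse_structure (Pi\<^sub>E I X) (product_coarse I X \<E>)"
  unfolding coarse_structure_def
proof (intro conjI ballI allI impI)
  fix E assume "E \<in> product_coarse I X \<E>"
  then show "entourage (Pi\<^sub>E I X) E"
    by (simp add: product_coarse_def coarse_generated_def)
next
  fix E F assume "E \<in> product_coarse I X \<E>" "F \<in> product_coarse I X \<E>"
  then obtain A B where A: "\<forall>i\<in>I. A i \<in> \<E> i" "E \<subseteq> product_entourage I X A"
    and B: "\<forall>i\<in>I. B i \<in> \<E> i" "F \<subseteq> product_entourage I X B"
    unfolding product_coarse_def coarse_generated_def by blast
  have "\<forall>i\<in>I. \<exists>C. C \<in> \<E> i \<and> A i O B i \<subseteq> C"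
    using assms A(1) B(1) unfolding coarse_structure_def by meson
  then obtain C where C: "\<forall>i\<in>I. C i \<in> \<E> i \<and> A i O B i \<subseteq> C i"
    by metis
  have "entourage (Pi\<^sub>E I X) (product_entourage I X C)"
    using assms C by (intro entourage_product_entourage) (auto simp: coarse_structure_def)
  then have "product_entourage I X C \<in> product_coarse I X \<E>"
    using C unfolding product_coarse_def coarse_generated_def by blast
  moreover have "E O F \<subseteq> product_entourage I X C"
  proof
    fix p assume "p \<in> E O F"
    then obtain x y z where p: "p = (x, z)" "(x, y) \<in> E" "(y, z) \<in> F" by blast
    then have "(x, y) \<in> product_entourage I X A" "(y, z) \<in> product_entourage I X B"
      using A(2) B(2) by auto
    then show "p \<in> product_entourage I X C"
      using C p(1) unfolding product_entourage_def by blast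
  qed
  ultimately show "\<exists>G\<in>product_coarse I X \<E>. E O F \<subseteq> G" by blast
next
  fix E F assume "E \<in> product_coarse I X \<E>" "entourage (Pi\<^sub>E I X) F \<and> F \<subseteq> E"
  then show "F \<in> product_coarse I X \<E>"
    unfolding product_coarse_def coarse_generated_def by blast
qed

end

theory Submission
  imports Defs "HOL-Analysis.Brouwer_Fixpoint"
begin

text \<open>
  If \<open>asdim (X i) \<ge> 1\<close>, some entourage \<open>E i\<close> admits \<open>E i\<close>-chains whose two ends are not related by
  any prescribed member of the coarse structure: otherwise the \<open>E i\<close>-chain components would form
  a uniformly bounded cover of multiplicity one. The product of such chains is a discrete cube in the
  product space, and when the chains are long compared with a uniformly bounded cover, no member of
  the cover meets two opposite faces of this cube. By the combinatorial form of Lebesgue's covering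
  theorem some unit cube then meets at least \<open>n + 1\<close> members of the cover, and this unit cube lies in
  a single ball of the product of the entourages \<open>E i\<close>.
\<close>

lemma enat_le_asdim_iff: "enat n \<le> asdim X \<E> \<longleftrightarrow> (\<forall>m. asdim_le X \<E> m \<longrightarrow> n \<le> m)"
proof (cases "\<exists>m. asdim_le X \<E> m")
  case True
  have "asdim_le X \<E> (LEAST m. asdim_le X \<E> m)"
    using True by (rule LeastI_ex)
  moreover have "(LEAST m. asdim_le X \<E> m) \<le> m" if "asdim_le X \<E> m" for m
    using that by (rule Least_le)
  ultimately show ?thesis
    using True unfolding asdim_def by (auto intro: order_trans)
next
  case False
  then show ?thesis by (auto simp: asdim_def)
qed

text \<open>Kuhn's combinatorial lemma, the discrete core of Brouwer's theorem, applied to 0/1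
  labels read off the colours: bit \<open>j\<close> tells whether a colour occurs on the face
  \<open>x j = 0\<close>. A fully labelled Kuhn simplex fits into the unit cube with lowest corner
  \<open>b\<close>.\<close>

lemma discrete_lebesgue_covering:
  fixes col :: "(nat \<Rightarrow> nat) \<Rightarrow> 'c"
  assumes "0 < p"
    and opposite: "\<And>x y i. \<lbrakk>\<forall>j. x j \<le> p; \<forall>j. y j \<le> p; i < n; x i = 0; y i = p\<rbrakk> \<Longrightarrow> col x \<noteq> col y"
  obtains b S where "finite S" "\<And>j. b j \<le> p"
    "\<And>a j. a \<in> S \<Longrightarrow> a j \<le> p \<and> b j \<le> a j \<and> a j \<le> Suc (b j)"
    "n + 1 \<le> card (col ` S)"
proof -
  \<comment> \<open>The label of \<open>x\<close> depends only on \<open>col x\<close>, so distinct reduced labels force distinct colours.\<close>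
  define touches where "touches c j \<longleftrightarrow> (\<exists>y. (\<forall>j. y j \<le> p) \<and> y j = 0 \<and> col y = c)" for c j
  define lab :: "'c \<Rightarrow> nat \<Rightarrow> nat" where "lab c j = (if touches c j then 0 else 1)" for c j
  let ?A = "{s. ksimplex p n s \<and> (reduced n \<circ> (lab \<circ> col)) ` s = {..n}}"
  have "odd (card ?A)"
  proof (rule kuhn_combinatorial[OF \<open>0 < p\<close>])
    \<comment> \<open>A point of the face \<open>x j = 0\<close> is its own witness for
      \<open>touches\<close>; on the face \<open>x j = p\<close> the assumption
      \<open>opposite\<close> excludes any witness.\<close>
    show "\<forall>x j. (\<forall>j. x j \<le> p) \<and> j < n \<and> x j = 0 \<longrightarrow> (lab \<circ> col) x j = 0"
      unfolding lab_def touches_def comp_def by metis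
    show "\<forall>x j. (\<forall>j. x j \<le> p) \<and> j < n \<and> x j = p \<longrightarrow> (lab \<circ> col) x j = 1"
      using opposite unfolding lab_def touches_def comp_def by metis
  qed
  then have "?A \<noteq> {}"
    by (rule odd_card_imp_not_empty)
  then obtain s b u where "kuhn_simplex p n b u s"
    and labels: "(reduced n \<circ> (lab \<circ> col)) ` s = {..n}"
    by (auto elim: ksimplex.cases)
  interpret kuhn_simplex p n b u s by fact
  have fin: "finite s"
    by (simp add: s_eq)
  have "{..n} = (reduced n \<circ> lab) ` (col ` s)"
    using labels by (simp add: image_comp comp_assoc)
  then have "n + 1 \<le> card (col ` s)"
    using card_image_le[of "col ` s" "reduced n \<circ> lab"] fin
    by (metis Suc_eq_plus1 card_atMost finite_imageI)
  then show thesis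
    using that[of s b] fin s_le_p base_le le_Suc_base base_in_s by blast
qed

text \<open>\<open>E\<close> is fixed before \<open>F\<close>, so one scale serves against every
  bound. The chains are infinite and eventually constant, so that chains in different factors can be
  cut at a common length.\<close>

lemma asdim_pos_imp_long_chains:
  assumes cs: "coarse_structure X \<E>" and "\<not> asdim_le X \<E> 0"
  obtains E where "E \<in> \<E>"
    "\<And>F. F \<in> \<E> \<Longrightarrow> \<exists>c m. (\<forall>k. (c k, c (Suc k)) \<in> E) \<and> (\<forall>k\<ge>m. (c 0, c k) \<notin> F)"
proof -
  obtain E where E: "E \<in> \<E>"
    and bad: "\<And>\<U>. uniformly_bounded_cover X \<E> \<U> \<Longrightarrow>
      \<exists>x\<in>X. \<not> (finite {U\<in>\<U>. E `` {x} \<inter> U \<noteq> {}} \<and> card {U\<in>\<U>. E `` {x} \<inter> U \<noteq> {}} \<le> 1)"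
    using assms(2) unfolding asdim_le_def by auto
  have "entourage X E"
    using cs E by (auto simp: coarse_structure_def)
  then have EX: "E \<subseteq> X \<times> X" and refl: "\<And>x. x \<in> X \<Longrightarrow> (x, x) \<in> E" and "sym E"
    unfolding entourage_def by (auto simp: sym_conv_converse_eq)
  have star_sym: "(y, x) \<in> E\<^sup>*" if "(x, y) \<in> E\<^sup>*" for x y
    using sym_rtrancl[OF \<open>sym E\<close>] that by (auto dest: symD)
  have star_X: "y \<in> X" if "(x, y) \<in> E\<^sup>*" "x \<in> X" for x y
    using that(1) by (cases rule: rtranclE) (use that EX in auto)
  define \<U> where "\<U> = (\<lambda>x. E\<^sup>* `` {x}) ` X"
  have comp_eq: "E\<^sup>* `` {x} = E\<^sup>* `` {y}" if "(x, y) \<in> E\<^sup>*" for x y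
    using that star_sym by (auto intro: rtrancl_trans)
  \<comment> \<open>A ball stays inside the chain component of its centre, so it meets no other
    component; by \<open>bad\<close> the cover by components can then fail only by being
    unbounded.\<close>
  have mult: "{U\<in>\<U>. E `` {x} \<inter> U \<noteq> {}} \<subseteq> {E\<^sup>* `` {x}}" for x
  proof
    fix U assume "U \<in> {U\<in>\<U>. E `` {x} \<inter> U \<noteq> {}}"
    then obtain z y where "U = E\<^sup>* `` {z}" "(x, y) \<in> E" "(z, y) \<in> E\<^sup>*"
      by (auto simp: \<U>_def)
    then show "U \<in> {E\<^sup>* `` {x}}"
      using comp_eq[of z y] comp_eq[of x y] by auto
  qed
  have unbdd: "\<not> uniformly_bounded_cover X \<E> \<U>"
  proof
    assume "uniformly_bounded_cover X \<E> \<U>"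
    then show False
      using bad finite_subset[OF mult] card_mono[OF _ mult] by fastforce
  qed
  have "\<exists>c m. (\<forall>k. (c k, c (Suc k)) \<in> E) \<and> (\<forall>k\<ge>m. (c 0, c k) \<notin> F)" if "F \<in> \<E>" for F
  proof -
    \<comment> \<open>Otherwise \<open>F\<close> would bound all components uniformly.\<close>
    have "\<exists>x y. x \<in> X \<and> (x, y) \<in> E\<^sup>* \<and> (x, y) \<notin> F"
    proof (rule ccontr)
      assume "\<not> ?thesis"
      then have inF: "(x, y) \<in> F" if "x \<in> X" "(x, y) \<in> E\<^sup>*" for x y
        using that by blast
      have "U \<times> U \<subseteq> F" if U: "U \<in> \<U>" for U
      proof -
        obtain z where z: "z \<in> X" "U = E\<^sup>* `` {z}"
          using U by (auto simp: \<U>_def)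
        show ?thesis
        proof clarify
          fix x y assume "x \<in> U" "y \<in> U"
          then have "(z, x) \<in> E\<^sup>*" "(z, y) \<in> E\<^sup>*"
            using z by auto
          then show "(x, y) \<in> F"
            using inF star_X[of z x] z(1) star_sym[of z x] rtrancl_trans[of x z E y] by blast
        qed
      qed
      moreover have "\<Union>\<U> = X"
        using star_X by (auto simp: \<U>_def)
      moreover have "\<forall>U\<in>\<U>. U \<subseteq> X"
        using \<open>\<Union>\<U> = X\<close> by blast
      ultimately show False
        using unbdd \<open>F \<in> \<E>\<close> unfolding uniformly_bounded_cover_def by metis
    qed
    then obtain x y m where "x \<in> X" "(x, y) \<in> E ^^ m" "(x, y) \<notin> F"
      using rtrancl_imp_relpow by metis
    then obtain f where f: "f 0 = x" "f m = y" "\<forall>i<m. (f i, f (Suc i)) \<in> E"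
      by (auto simp: relpow_fun_conv)
    have "y \<in> X"
      using star_X \<open>x \<in> X\<close> relpow_imp_rtrancl \<open>(x, y) \<in> E ^^ m\<close> by metis
    \<comment> \<open>The finite chain is prolonged by staying at \<open>y\<close>, which is a legal
      step because \<open>E\<close> is reflexive on \<open>X\<close>.\<close>
    have "(f (min k m), f (min (Suc k) m)) \<in> E" for k
      using f refl[OF \<open>y \<in> X\<close>] by (cases "k < m") (auto simp: min_def)
    moreover have "(f (min 0 m), f (min k m)) \<notin> F" if "k \<ge> m" for k
      using f \<open>(x, y) \<notin> F\<close> that by (simp add: min_def)
    ultimately show ?thesis
      by (intro exI[of _ "\<lambda>k. f (min k m)"] exI[of _ m]) blast
  qed
  with E show thesis
    using that by blast
qed

theorem theorem1:
  fixes n :: nat and X :: "nat \<Rightarrow> 'a set" and \<E> :: "nat \<Rightarrow> 'a rel set"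
  assumes "n \<ge> 1"
    and "\<And>i. i \<in> {1..n} \<Longrightarrow> coarse_structure (X i) (\<E> i)"
    and "\<And>i. i \<in> {1..n} \<Longrightarrow> asdim (X i) (\<E> i) \<ge> 1"
  shows "asdim (Pi\<^sub>E {1..n} X) (product_coarse {1..n} X \<E>) \<ge> enat n"
  unfolding enat_le_asdim_iff
proof (intro allI impI)
  let ?I = "{1..n}"
  fix d assume le: "asdim_le (Pi\<^sub>E ?I X) (product_coarse ?I X \<E>) d"
  have "\<exists>E. E \<in> \<E> i \<and> (\<forall>F\<in>\<E> i. \<exists>c m. (\<forall>k. (c k, c (Suc k)) \<in> E) \<and> (\<forall>k\<ge>m. (c 0, c k) \<notin> F))"
    if "i \<in> ?I" for i
  proof -
    have "\<not> asdim_le (X i) (\<E> i) 0"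
      using assms(3)[OF that] by (auto simp: one_enat_def enat_le_asdim_iff)
    then show ?thesis
      using asdim_pos_imp_long_chains[OF assms(2)[OF that]] by metis
  qed
  then obtain E where E: "\<And>i. i \<in> ?I \<Longrightarrow> E i \<in> \<E> i"
    and chains: "\<And>i F. i \<in> ?I \<Longrightarrow> F \<in> \<E> i \<Longrightarrow>
      \<exists>c m. (\<forall>k. (c k, c (Suc k)) \<in> E i) \<and> (\<forall>k\<ge>m. (c 0, c k) \<notin> F)"
    by metis
  have ent: "entourage (X i) (E i)" if "i \<in> ?I" for i
    using assms(2)[OF that] E[OF that] by (auto simp: coarse_structure_def)
  let ?E = "product_entourage ?I X E"
  have "?E \<in> product_coarse ?I X \<E>"
    using E entourage_product_entourage[of ?I X E] ent
    unfolding product_coarse_def coarse_generated_def by blast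
  then obtain \<U> where cover: "uniformly_bounded_cover (Pi\<^sub>E ?I X) (product_coarse ?I X \<E>) \<U>"
    and mult: "\<And>x. x \<in> Pi\<^sub>E ?I X \<Longrightarrow>
      finite {U\<in>\<U>. ?E `` {x} \<inter> U \<noteq> {}} \<and> card {U\<in>\<U>. ?E `` {x} \<inter> U \<noteq> {}} \<le> d + 1"
    using le unfolding asdim_le_def by blast
  obtain B where B: "B \<in> product_coarse ?I X \<E>" "\<And>U. U \<in> \<U> \<Longrightarrow> U \<times> U \<subseteq> B"
    using cover unfolding uniformly_bounded_cover_def by metis
  obtain F where "\<forall>i\<in>?I. F i \<in> \<E> i" and BF: "B \<subseteq> product_entourage ?I X F"
    using B(1) unfolding product_coarse_def coarse_generated_def by blast
  then have F: "F i \<in> \<E> i" if "i \<in> ?I" for i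
    using that by blast
  have bdd: "U \<times> U \<subseteq> product_entourage ?I X F" if "U \<in> \<U>" for U
    using B(2)[OF that] BF by (rule order_trans)
  \<comment> \<open>The chains are chosen after the cover, to outrun its bound \<open>F i\<close> in
    each factor.\<close>
  obtain c m where step: "\<And>i k. i \<in> ?I \<Longrightarrow> (c i k, c i (Suc k)) \<in> E i"
    and far: "\<And>i k. i \<in> ?I \<Longrightarrow> m i \<le> k \<Longrightarrow> (c i 0, c i k) \<notin> F i"
  proof -
    have "\<forall>i\<in>?I. \<exists>c m. (\<forall>k. (c k, c (Suc k)) \<in> E i) \<and> (\<forall>k\<ge>m. (c 0, c k) \<notin> F i)"
      using chains F by blast
    then show thesis
      unfolding bchoice_iff using that by blast
  qed
  \<comment> \<open>The sum dominates every \<open>m i\<close>, and the successor makes the side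
    length positive.\<close>
  define p where "p = Suc (\<Sum>i\<in>?I. m i)"
  have m_le: "m i \<le> p" if "i \<in> ?I" for i
    using member_le_sum[of i ?I m] that by (simp add: p_def)
  have c_X: "c i k \<in> X i" if "i \<in> ?I" for i k
    using step[OF that, of k] ent[OF that] by (auto simp: entourage_def)
  have c_refl: "(c i k, c i k) \<in> E i" if "i \<in> ?I" for i k
    using c_X[OF that] ent[OF that] by (auto simp: entourage_def)
  \<comment> \<open>The grid of chains; the shift matches the factors \<open>1..n\<close> with the
    cube coordinates \<open>0..n-1\<close>.\<close>
  define g where "g x = (\<lambda>i\<in>?I. c i (x (i - 1)))" for x
  have g_X: "g x \<in> Pi\<^sub>E ?I X" for x
    using c_X by (auto simp: g_def)
  have "\<exists>U. U \<in> \<U> \<and> g x \<in> U" for x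
    using g_X[of x] cover unfolding uniformly_bounded_cover_def by (metis UnionE)
  then obtain col where col: "\<And>x. col x \<in> \<U>" "\<And>x. g x \<in> col x"
    by metis
  obtain b S where "finite S" and S: "\<And>a j. a \<in> S \<Longrightarrow> b j \<le> a j \<and> a j \<le> Suc (b j)"
    and many: "n + 1 \<le> card (col ` S)"
  proof (rule discrete_lebesgue_covering[of p n col])
    show "0 < p" by (simp add: p_def)
    show "col x \<noteq> col y" if "i < n" "x i = 0" "y i = p" for x y i
    proof
      assume "col x = col y"
      then have "(g x, g y) \<in> product_entourage ?I X F"
        using bdd col by (metis mem_Sigma_iff subsetD)
      then have "(g x (Suc i), g y (Suc i)) \<in> F (Suc i)"
        using \<open>i < n\<close> by (auto simp: product_entourage_def)
      then show False
        using that far[of "Suc i" p] m_le[of "Suc i"] by (simp add: g_def)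
    qed
  qed blast
  \<comment> \<open>In each factor, \<open>a\<close> and \<open>b\<close> agree or differ by one
    chain step.\<close>
  have near: "(g b, g a) \<in> ?E" if "a \<in> S" for a
  proof -
    have "(c i (b (i - 1)), c i (a (i - 1))) \<in> E i" if "i \<in> ?I" for i
    proof -
      have "a (i - 1) = b (i - 1) \<or> a (i - 1) = Suc (b (i - 1))"
        using S[OF \<open>a \<in> S\<close>, of "i - 1"] by linarith
      then show ?thesis
        using c_refl[OF that] step[OF that] by metis
    qed
    then show ?thesis
      using g_X by (auto simp: product_entourage_def g_def)
  qed
  \<comment> \<open>Each \<open>col a\<close> contains \<open>g a\<close>, a point of the ball
    around \<open>g b\<close>, so all these colours count at the single point
    \<open>g b\<close>.\<close>
  have "col ` S \<subseteq> {U\<in>\<U>. ?E `` {g b} \<inter> U \<noteq> {}}"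
    using near col by blast
  then have "card (col ` S) \<le> d + 1"
    using mult[OF g_X[of b]] by (meson card_mono order_trans)
  with many show "n \<le> d" by simp
qed

end
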